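(* Let $G$ and $H$ be finite simple undirected graphs, where $G$ has $s_1$ vertices and $t_1$ edges and $H$ has $s_2$ vertices and $t_2$ edges. Then $$Mo(G+H)\le irr(G)+irr(H)+s_1s_2\,|s_2-s_1|+2(s_2t_1+s_1t_2).$$
   Context: For a graph $X$ and an edge $e=uv$ of $X$, $n_u(e\mid X)$ denotes the number of vertices $w$ of $X$ with $d_X(w,u)<d_X(w,v)$ ($d_X$ the shortest-path distance). The Mostar index is $Mo(X)=\sum_{uv\in E(X)}|n_u(e\mid X)-n_v(e\mid X)|$. The irregularity is $irr(X)=\sum_{uv\in E(X)}|\deg_X(u)-\deg_X(v)|$. The join $G+H$ is the disjoint union of $G$ and $H$ together with all edges joining a vertex of $G$ to a vertex of $H$. *)

theory Defs
  imports Complex_Main "HOL-Library.Extended_Nat"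
begin

record 'a ugraph =
  verts :: "'a set"
  edges :: "'a set set"

definition simple_graph :: "'a ugraph \<Rightarrow> bool" where
  "simple_graph X \<longleftrightarrow>
     finite (verts X) \<and> (\<forall>e\<in>edges X. e \<subseteq> verts X \<and> card e = 2)"

definition graph_path :: "'a ugraph \<Rightarrow> 'a list \<Rightarrow> bool" where
  "graph_path X p \<longleftrightarrow>
     p \<noteq> [] \<and> distinct p \<and> set p \<subseteq> verts X \<and>
     (\<forall>i. Suc i < length p \<longrightarrow> {p ! i, p ! Suc i} \<in> edges X)"

text \<open>The infimum of the empty set is \<open>\<infinity>\<close>, so vertices in different components are at
  distance \<open>\<infinity>\<close>.\<close>

definition graph_dist :: "'a ugraph \<Rightarrow> 'a \<Rightarrow> 'a \<Rightarrow> enat" where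
  "graph_dist X u v =
     (INF p\<in>{p. graph_path X p \<and> hd p = u \<and> last p = v}. enat (length p - 1))"

definition deg :: "'a ugraph \<Rightarrow> 'a \<Rightarrow> nat" where
  "deg X u = card {e \<in> edges X. u \<in> e}"

text \<open>\<open>n_closer X u v\<close> is $n_u(e \mid X)$ for the edge $e = uv$.\<close>

definition n_closer :: "'a ugraph \<Rightarrow> 'a \<Rightarrow> 'a \<Rightarrow> nat" where
  "n_closer X u v = card {w \<in> verts X. graph_dist X w u < graph_dist X w v}"

text \<open>Sum of \<open>f u v\<close> over the unordered edges \<open>uv\<close>, each counted once. It is meant for
  symmetric \<open>f\<close>, for which the description is well defined on every two-element edge.\<close>

definition edge_sum :: "'a ugraph \<Rightarrow> ('a \<Rightarrow> 'a \<Rightarrow> int) \<Rightarrow> int" where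
  "edge_sum X f = (\<Sum>e\<in>edges X. THE k. \<exists>u v. e = {u, v} \<and> k = f u v)"

lemma edge_sum_summand:
  assumes "\<And>u v. f u v = f v u"
  shows "(THE k. \<exists>u v. {a, b} = {u, v} \<and> k = f u v) = f a b"
  using assms by (intro the_equality) (auto simp: doubleton_eq_iff)

definition Mo :: "'a ugraph \<Rightarrow> int" where
  "Mo X = edge_sum X (\<lambda>u v. \<bar>int (n_closer X u v) - int (n_closer X v u)\<bar>)"

definition irr :: "'a ugraph \<Rightarrow> int" where
  "irr X = edge_sum X (\<lambda>u v. \<bar>int (deg X u) - int (deg X v)\<bar>)"

definition graph_join :: "'a ugraph \<Rightarrow> 'b ugraph \<Rightarrow> ('a + 'b) ugraph" where
  "graph_join G H = \<lparr>
     verts = verts G <+> verts H,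
     edges = (`) Inl ` edges G \<union> (`) Inr ` edges H \<union>
       {{Inl u, Inr v} | u v. u \<in> verts G \<and> v \<in> verts H}\<rparr>"

end

theory Submission
  imports Defs
begin

text \<open>In a graph of diameter at most two, a vertex is strictly closer to \<open>u\<close> than to its neighbour
  \<open>v\<close> iff it is \<open>u\<close> itself, or a neighbour of \<open>u\<close> that is neither \<open>v\<close> nor a neighbour of \<open>v\<close>.
  Hence $n_u - n_v = \deg u - \deg v$ and the Mostar index is the irregularity. A join of nonempty
  graphs has diameter at most two. Joining shifts all degrees of \<open>G\<close> by \<open>s2\<close> and all degrees of
  \<open>H\<close> by \<open>s1\<close>, so the old edges contribute \<open>irr G + irr H\<close>, and the new ones are estimated by the
  triangle inequality and the handshake lemma.\<close>

section \<open>Neighbourhoods, degrees and the handshake lemma\<close>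

definition nbrs :: "'a ugraph \<Rightarrow> 'a \<Rightarrow> 'a set" where
  "nbrs X u = {w. {u, w} \<in> edges X}"

lemma nbrs_sym: "v \<in> nbrs X u \<longleftrightarrow> u \<in> nbrs X v"
  by (simp add: nbrs_def insert_commute)

lemma simple_graph_edgeE:
  assumes "simple_graph X" "e \<in> edges X"
  obtains u v where "e = {u, v}" "u \<noteq> v" "u \<in> verts X" "v \<in> verts X"
proof -
  have "e \<subseteq> verts X" "card e = 2"
    using assms by (auto simp: simple_graph_def)
  with that show thesis
    by (auto simp: card_2_iff)
qed

lemma simple_graph_edgeD:
  assumes "simple_graph X" "{u, v} \<in> edges X"
  shows "u \<noteq> v" "u \<in> verts X" "v \<in> verts X"
  using assms(2) simple_graph_edgeE[OF assms] by (auto simp: doubleton_eq_iff)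

lemma finite_edges:
  assumes "simple_graph X"
  shows "finite (edges X)"
proof (rule finite_subset)
  show "edges X \<subseteq> Pow (verts X)"
    using assms by (auto simp: simple_graph_def)
  show "finite (Pow (verts X))"
    using assms by (simp add: simple_graph_def)
qed

lemma nbrs_subset_verts: "simple_graph X \<Longrightarrow> nbrs X u \<subseteq> verts X"
  by (auto simp: nbrs_def dest: simple_graph_edgeD)

lemma finite_nbrs: "simple_graph X \<Longrightarrow> finite (nbrs X u)"
  by (meson finite_subset nbrs_subset_verts simple_graph_def)

text \<open>Since edges have exactly two ends, \<open>w\<close> \<mapsto> \<open>{u, w}\<close> is a
  bijection from the neighbours of \<open>u\<close> onto the edges at \<open>u\<close>. Degrees thus
  become comparable with vertex counts such as \<open>n_closer\<close>.\<close>

lemma deg_eq_card_nbrs: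
  assumes "simple_graph X"
  shows "deg X u = card (nbrs X u)"
proof -
  have "e \<in> (\<lambda>w. {u, w}) ` nbrs X u" if e: "e \<in> edges X" "u \<in> e" for e
  proof -
    obtain w where "e = {u, w}"
      using simple_graph_edgeE[OF assms e(1)] e(2) by (metis insertE insert_commute singletonD)
    with e(1) show ?thesis
      by (auto simp: nbrs_def)
  qed
  then have "{e \<in> edges X. u \<in> e} = (\<lambda>w. {u, w}) ` nbrs X u"
    by (auto simp: nbrs_def)
  moreover have "inj_on (\<lambda>w. {u, w}) (nbrs X u)"
    by (auto simp: inj_on_def doubleton_eq_iff)
  ultimately show ?thesis
    by (simp add: deg_def card_image)
qed

text \<open>Double counting of incident pairs of a vertex and an edge: each edge has two
  ends.\<close>

lemma sum_deg:
  assumes "simple_graph X"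
  shows "(\<Sum>v\<in>verts X. deg X v) = 2 * card (edges X)"
proof -
  have fin: "finite (verts X)"
    using assms by (simp add: simple_graph_def)
  have inc: "{v \<in> verts X. v \<in> e} = e" if "e \<in> edges X" for e
    using assms that by (auto simp: simple_graph_def)
  have "(\<Sum>v\<in>verts X. deg X v) = (\<Sum>e\<in>edges X. card {v \<in> verts X. v \<in> e})"
    unfolding deg_def
    using sum.swap_restrict[OF fin finite_edges[OF assms], of "\<lambda>_ _. 1::nat" "\<lambda>v e. v \<in> e"]
    by simp
  also have "\<dots> = (\<Sum>e\<in>edges X. 2)"
    using assms inc by (intro sum.cong) (auto simp: simple_graph_def)
  finally show ?thesis
    by simp
qed

section \<open>Distances zero, one and two\<close>

lemma graph_dist_le: "graph_path X p \<Longrightarrow> graph_dist X (hd p) (last p) \<le> enat (length p - 1)"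
  unfolding graph_dist_def by (intro INF_lower) simp

lemma graph_dist_ge:
  assumes "\<And>p. graph_path X p \<Longrightarrow> hd p = u \<Longrightarrow> last p = v \<Longrightarrow> n \<le> enat (length p - 1)"
  shows "n \<le> graph_dist X u v"
  unfolding graph_dist_def by (intro INF_greatest) (use assms in auto)

lemma graph_dist_self: "u \<in> verts X \<Longrightarrow> graph_dist X u u = 0"
  using graph_dist_le[of X "[u]"] by (simp add: graph_path_def flip: zero_enat_def)

lemma one_le_graph_dist:
  assumes "u \<noteq> v"
  shows "1 \<le> graph_dist X u v"
proof (rule graph_dist_ge)
  fix p assume p: "graph_path X p" "hd p = u" "last p = v"
  obtain x q where "p = x # q"
    using p(1) by (cases p) (auto simp: graph_path_def)
  with p assms have "length p - 1 \<ge> 1"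
    by (cases q) auto
  then show "1 \<le> enat (length p - 1)"
    by (simp add: one_enat_def)
qed

text \<open>A path with a single vertex would force \<open>u = v\<close>, and one with two vertices
  would make \<open>v\<close> a neighbour of \<open>u\<close>, so every path has at least three
  vertices.\<close>

lemma two_le_graph_dist:
  assumes "u \<noteq> v" "v \<notin> nbrs X u"
  shows "2 \<le> graph_dist X u v"
proof (rule graph_dist_ge)
  fix p assume p: "graph_path X p" "hd p = u" "last p = v"
  obtain x q where q: "p = x # q"
    using p(1) by (cases p) (auto simp: graph_path_def)
  obtain y r where r: "q = y # r"
    using p q assms(1) by (cases q) auto
  have "r \<noteq> []"
    using p q r assms(2) by (auto simp: graph_path_def nbrs_def)
  then have "length p - 1 \<ge> 2"
    using q r by (cases r) auto
  then show "2 \<le> enat (length p - 1)"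
    by (simp add: numeral_eq_enat)
qed

lemma graph_dist_nbr:
  assumes "simple_graph X" "v \<in> nbrs X u"
  shows "graph_dist X u v = 1"
proof (rule antisym)
  have "{u, v} \<in> edges X"
    using assms(2) by (simp add: nbrs_def)
  note uv = this simple_graph_edgeD[OF assms(1) this]
  then have "graph_path X [u, v]"
    by (simp add: graph_path_def)
  from graph_dist_le[OF this] show "graph_dist X u v \<le> 1"
    by (simp add: one_enat_def)
  show "1 \<le> graph_dist X u v"
    using uv by (intro one_le_graph_dist)
qed

lemma graph_dist_common_nbr:
  assumes "simple_graph X" "u \<noteq> v" "v \<notin> nbrs X u" "w \<in> nbrs X u" "w \<in> nbrs X v"
  shows "graph_dist X u v = 2"
proof (rule antisym)
  have uw: "{u, w} \<in> edges X" and wv: "{w, v} \<in> edges X"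
    using assms(4,5) by (simp_all add: nbrs_def insert_commute)
  have "graph_path X [u, w, v]"
    using uw wv assms(2) simple_graph_edgeD[OF assms(1) uw] simple_graph_edgeD[OF assms(1) wv]
    by (auto simp: graph_path_def nth_Cons split: nat.split)
  from graph_dist_le[OF this] show "graph_dist X u v \<le> 2"
    by (simp add: numeral_eq_enat numeral_2_eq_2)
  show "2 \<le> graph_dist X u v"
    using assms by (intro two_le_graph_dist)
qed

section \<open>Graphs of diameter at most two\<close>

text \<open>Phrased by common neighbours rather than by \<open>graph_dist\<close>, so that it can be
  checked in a join from the neighbourhoods alone.\<close>

definition diam_le_two :: "'a ugraph \<Rightarrow> bool" where
  "diam_le_two X \<longleftrightarrow>
     (\<forall>u\<in>verts X. \<forall>v\<in>verts X. u = v \<or> v \<in> nbrs X u \<or> nbrs X u \<inter> nbrs X v \<noteq> {})"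

lemma graph_dist_diam_le_two:
  assumes "simple_graph X" "diam_le_two X" "u \<in> verts X" "v \<in> verts X"
  shows "graph_dist X u v = (if u = v then 0 else if v \<in> nbrs X u then 1 else 2)"
proof -
  have "graph_dist X u v = 2" if "u \<noteq> v" "v \<notin> nbrs X u"
  proof -
    have "nbrs X u \<inter> nbrs X v \<noteq> {}"
      using assms(2-4) that unfolding diam_le_two_def by blast
    then obtain w where "w \<in> nbrs X u" "w \<in> nbrs X v"
      by blast
    then show ?thesis
      by (rule graph_dist_common_nbr[OF assms(1) that])
  qed
  then show ?thesis
    using assms by (simp add: graph_dist_self graph_dist_nbr)
qed

text \<open>The correction term, the number of common neighbours, is symmetric in \<open>u\<close>
  and \<open>v\<close>, so it cancels when the two counts at an edge are compared. The additive form
  avoids subtraction on naturals.\<close>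

lemma n_closer_diam_le_two:
  assumes "simple_graph X" "diam_le_two X" "{u, v} \<in> edges X"
  shows "n_closer X u v + card (nbrs X u \<inter> nbrs X v) = deg X u"
proof -
  note uv = simple_graph_edgeD[OF assms(1,3)]
  have vu: "v \<in> nbrs X u" "u \<in> nbrs X v"
    using assms(3) by (simp_all add: nbrs_def insert_commute)
  have irrefl: "w \<notin> nbrs X w" for w
    using simple_graph_edgeD(1)[OF assms(1), of w w] by (auto simp: nbrs_def)
  have fin: "finite (nbrs X w)" for w
    by (rule finite_nbrs[OF assms(1)])
  \<comment> \<open>All distances are 0, 1 or 2. For \<open>w\<close> other than \<open>u\<close>,
    being closer to \<open>u\<close> means distance 1 to \<open>u\<close> and 2 to \<open>v\<close>;
    \<open>v\<close> has to be removed explicitly, as it lies in \<open>nbrs X u - nbrs X v\<close>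
    but has distance 0 to itself.\<close>
  have "graph_dist X w u < graph_dist X w v \<longleftrightarrow> w \<in> insert u (nbrs X u - nbrs X v - {v})"
    if "w \<in> verts X" for w
  proof -
    have "u \<in> nbrs X w \<longleftrightarrow> w \<in> nbrs X u" "v \<in> nbrs X w \<longleftrightarrow> w \<in> nbrs X v"
      by (rule nbrs_sym)+
    then show ?thesis
      using that uv vu by (simp add: graph_dist_diam_le_two[OF assms(1,2)])
  qed
  then have "{w \<in> verts X. graph_dist X w u < graph_dist X w v}
      = insert u (nbrs X u - nbrs X v - {v})"
    using uv nbrs_subset_verts[OF assms(1), of u] by blast
  then have "n_closer X u v = Suc (card (nbrs X u - nbrs X v - {v}))"
    using fin irrefl by (simp add: n_closer_def)
  \<comment> \<open>The vertex \<open>u\<close> that was added makes up for \<open>v\<close> that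
    was removed.\<close>
  also have "\<dots> = card (nbrs X u - nbrs X v)"
    using fin irrefl vu by (intro card_Suc_Diff1) auto
  finally show ?thesis
    using fin card_Int_Diff[of "nbrs X u" "nbrs X v"] deg_eq_card_nbrs[OF assms(1)] by simp
qed

lemma Mo_diam_le_two:
  assumes "simple_graph X" "diam_le_two X"
  shows "Mo X = irr X"
  unfolding Mo_def irr_def edge_sum_def
proof (rule sum.cong[OF refl])
  fix e assume e: "e \<in> edges X"
  then obtain a b where ab: "e = {a, b}"
    using simple_graph_edgeE[OF assms(1)] by blast
  with e have "{a, b} \<in> edges X" "{b, a} \<in> edges X"
    by (simp_all add: insert_commute)
  then have "\<bar>int (n_closer X a b) - int (n_closer X b a)\<bar> = \<bar>int (deg X a) - int (deg X b)\<bar>"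
    by (simp add: Int_commute flip: n_closer_diam_le_two[OF assms])
  then show "(THE k. \<exists>u v. e = {u, v} \<and> k = \<bar>int (n_closer X u v) - int (n_closer X v u)\<bar>)
           = (THE k. \<exists>u v. e = {u, v} \<and> k = \<bar>int (deg X u) - int (deg X v)\<bar>)"
    unfolding ab by (subst (1 2) edge_sum_summand) auto
qed

section \<open>Splitting an edge sum over a join\<close>

text \<open>Taking images under an injection is injective on edges, so the sum can be reindexed. It
  serves both embedded copies inside the join, with \<open>h\<close> being \<open>Inl\<close> or
  \<open>Inr\<close>.\<close>

lemma sum_image_edges:
  assumes "simple_graph X" "inj h" "\<And>u v. f u v = f v u" "\<And>u v. F {h u, h v} = f u v"
  shows "sum F ((`) h ` edges X) = edge_sum X f"
proof -
  have "inj_on ((`) h) (edges X)"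
    using assms(2) by (meson inj_on_image inj_on_subset subset_UNIV)
  then have "sum F ((`) h ` edges X) = (\<Sum>e\<in>edges X. F (h ` e))"
    by (simp add: sum.reindex o_def)
  also have "\<dots> = edge_sum X f"
    unfolding edge_sum_def
  proof (rule sum.cong[OF refl])
    fix e assume "e \<in> edges X"
    then obtain a b where "e = {a, b}"
      using simple_graph_edgeE[OF assms(1)] by blast
    then show "F (h ` e) = (THE k. \<exists>u v. e = {u, v} \<and> k = f u v)"
      using edge_sum_summand[of f a b] assms(3,4) by simp
  qed
  finally show ?thesis .
qed

lemma edge_sum_graph_join:
  fixes G :: "'a ugraph" and H :: "'b ugraph"
  assumes G: "simple_graph G" and H: "simple_graph H" and sym: "\<And>u v. f u v = f v u"
  shows "edge_sum (graph_join G H) f =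
           edge_sum G (\<lambda>u v. f (Inl u) (Inl v)) + edge_sum H (\<lambda>u v. f (Inr u) (Inr v))
           + (\<Sum>u\<in>verts G. \<Sum>v\<in>verts H. f (Inl u) (Inr v))"
proof -
  define F where "F e = (THE k. \<exists>u v. e = {u, v} \<and> k = f u v)" for e
  have F: "F {u, v} = f u v" for u v
    unfolding F_def using sym by (rule edge_sum_summand)
  define A :: "('a + 'b) set set" where "A = (`) Inl ` edges G"
  define B :: "('a + 'b) set set" where "B = (`) Inr ` edges H"
  define C :: "('a + 'b) set set"
    where "C = (\<lambda>(u, v). {Inl u, Inr v}) ` (verts G \<times> verts H)"
  have E: "edges (graph_join G H) = A \<union> B \<union> C"
    by (auto simp: graph_join_def A_def B_def C_def)
  have finA: "finite A" and finB: "finite B" and finC: "finite C"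
    using G H by (auto simp: A_def B_def C_def finite_edges simple_graph_def)
  \<comment> \<open>Only cross edges contain vertices from both sides, which separates
    \<open>C\<close> from \<open>A\<close> and \<open>B\<close>.\<close>
  have AB: "\<not> (\<exists>u v. Inl u \<in> e \<and> Inr v \<in> e)" if "e \<in> A \<union> B" for e
    using that by (auto simp: A_def B_def)
  have "\<exists>u v. Inl u \<in> e \<and> Inr v \<in> e" if "e \<in> C" for e
    using that by (auto simp: C_def)
  with AB have disjC: "(A \<union> B) \<inter> C = {}"
    by (meson disjoint_iff)
  \<comment> \<open>The empty set is its own image under both \<open>Inl\<close> and
    \<open>Inr\<close>, so the disjointness of \<open>A\<close> and \<open>B\<close> rests on edges
    being nonempty.\<close>
  have "\<exists>u. Inl u \<in> e" if e: "e \<in> A" for e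
  proof -
    obtain e' where "e' \<in> edges G" "e = Inl ` e'"
      using e by (auto simp: A_def)
    then show ?thesis
      using simple_graph_edgeE[OF G] by blast
  qed
  moreover have "\<not> (\<exists>u. Inl u \<in> e)" if "e \<in> B" for e
    using that by (auto simp: B_def)
  ultimately have disjAB: "A \<inter> B = {}"
    by (meson disjoint_iff)
  have "edge_sum (graph_join G H) f = sum F A + sum F B + sum F C"
    unfolding edge_sum_def F_def[symmetric] E
    using finA finB finC disjAB disjC by (simp add: sum.union_disjoint)
  also have "sum F A = edge_sum G (\<lambda>u v. f (Inl u) (Inl v))"
    unfolding A_def by (rule sum_image_edges[OF G]) (simp_all add: F sym)
  also have "sum F B = edge_sum H (\<lambda>u v. f (Inr u) (Inr v))"
    unfolding B_def by (rule sum_image_edges[OF H]) (simp_all add: F sym)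
  also have "sum F C = (\<Sum>u\<in>verts G. \<Sum>v\<in>verts H. f (Inl u) (Inr v))"
  proof -
    have "inj_on (\<lambda>(u, v). {Inl u, Inr v}) (verts G \<times> verts H)"
      by (auto simp: inj_on_def doubleton_eq_iff)
    then show ?thesis
      unfolding C_def by (simp add: sum.reindex sum.cartesian_product F case_prod_unfold)
  qed
  finally show ?thesis .
qed

section \<open>Neighbourhoods, degrees and diameter of a join\<close>

lemma simple_graph_join:
  assumes "simple_graph G" "simple_graph H"
  shows "simple_graph (graph_join G H)"
proof -
  have "finite (verts (graph_join G H))"
    using assms by (simp add: simple_graph_def graph_join_def)
  moreover have "e \<subseteq> verts (graph_join G H) \<and> card e = 2" if "e \<in> edges (graph_join G H)" for e
  proof -
    from that consider (left) e' where "e' \<in> edges G" "e = Inl ` e'"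
      | (right) e' where "e' \<in> edges H" "e = Inr ` e'"
      | (cross) u v where "u \<in> verts G" "v \<in> verts H" "e = {Inl u, Inr v}"
      by (auto simp: graph_join_def)
    then show ?thesis
      by cases (auto simp: graph_join_def elim: simple_graph_edgeE[OF assms(1)]
          simple_graph_edgeE[OF assms(2)])
  qed
  ultimately show ?thesis
    by (simp add: simple_graph_def)
qed

lemma doubleton_in_image_iff:
  assumes "inj f"
  shows "{f u, f v} \<in> (`) f ` E \<longleftrightarrow> {u, v} \<in> E"
proof -
  have "inj ((`) f)"
    using assms by (simp add: inj_on_image)
  from inj_image_mem_iff[OF this, of "{u, v}" E] show ?thesis
    by simp
qed

lemma edges_graph_join_iff:
  "{Inl u, Inl u'} \<in> edges (graph_join G H) \<longleftrightarrow> {u, u'} \<in> edges G"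
  "{Inr v, Inr v'} \<in> edges (graph_join G H) \<longleftrightarrow> {v, v'} \<in> edges H"
  "{Inl u, Inr v} \<in> edges (graph_join G H) \<longleftrightarrow> u \<in> verts G \<and> v \<in> verts H"
proof -
  have "{Inl u, x} \<noteq> Inr ` e" "{y, Inr v} \<noteq> Inl ` e'" "{Inr v, y} \<noteq> Inl ` e'" for x y e e'
    by blast+
  then show
    "{Inl u, Inl u'} \<in> edges (graph_join G H) \<longleftrightarrow> {u, u'} \<in> edges G"
    "{Inr v, Inr v'} \<in> edges (graph_join G H) \<longleftrightarrow> {v, v'} \<in> edges H"
    "{Inl u, Inr v} \<in> edges (graph_join G H) \<longleftrightarrow> u \<in> verts G \<and> v \<in> verts H"
    by (auto simp: graph_join_def doubleton_in_image_iff doubleton_eq_iff)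
qed

lemma nbrs_graph_join_Inl:
  assumes "u \<in> verts G"
  shows "nbrs (graph_join G H) (Inl u) = nbrs G u <+> verts H"
proof (rule set_eqI)
  fix w
  show "w \<in> nbrs (graph_join G H) (Inl u) \<longleftrightarrow> w \<in> nbrs G u <+> verts H"
    using assms by (cases w) (auto simp: nbrs_def edges_graph_join_iff)
qed

lemma nbrs_graph_join_Inr:
  assumes "v \<in> verts H"
  shows "nbrs (graph_join G H) (Inr v) = verts G <+> nbrs H v"
proof (rule set_eqI)
  fix w
  show "w \<in> nbrs (graph_join G H) (Inr v) \<longleftrightarrow> w \<in> verts G <+> nbrs H v"
    using assms
    \<comment> \<open>The description of cross edges lists the \<open>Inl\<close> end first, hence
      the swap.\<close>
    by (cases w) (auto simp: nbrs_def edges_graph_join_iff insert_commute[of "Inr v" "Inl _"])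
qed

lemma deg_graph_join_Inl:
  assumes "simple_graph G" "simple_graph H" "u \<in> verts G"
  shows "deg (graph_join G H) (Inl u) = deg G u + card (verts H)"
proof -
  have "finite (verts G)" "finite (verts H)"
    using assms by (simp_all add: simple_graph_def)
  then show ?thesis
    using assms by (simp add: deg_eq_card_nbrs simple_graph_join nbrs_graph_join_Inl card_Plus
        finite_nbrs)
qed

lemma deg_graph_join_Inr:
  assumes "simple_graph G" "simple_graph H" "v \<in> verts H"
  shows "deg (graph_join G H) (Inr v) = deg H v + card (verts G)"
proof -
  have "finite (verts G)" "finite (verts H)"
    using assms by (simp_all add: simple_graph_def)
  then show ?thesis
    using assms by (simp add: deg_eq_card_nbrs simple_graph_join nbrs_graph_join_Inr card_Plus
        finite_nbrs)
qed

text \<open>Vertices on the same side share every vertex of the other, nonempty side as a neighbour;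
  vertices on different sides are adjacent.\<close>

lemma diam_le_two_graph_join:
  assumes "verts G \<noteq> {}" "verts H \<noteq> {}"
  shows "diam_le_two (graph_join G H)"
proof -
  obtain g h where gh: "g \<in> verts G" "h \<in> verts H"
    using assms by blast
  let ?N = "nbrs (graph_join G H)"
  have "Inr h \<in> ?N (Inl u) \<inter> ?N (Inl u')" if "u \<in> verts G" "u' \<in> verts G" for u u'
    using that gh by (simp add: nbrs_graph_join_Inl InrI)
  moreover have "Inl g \<in> ?N (Inr v) \<inter> ?N (Inr v')" if "v \<in> verts H" "v' \<in> verts H" for v v'
    using that gh by (simp add: nbrs_graph_join_Inr InlI)
  moreover have "Inr v \<in> ?N (Inl u)" "Inl u \<in> ?N (Inr v)" if "u \<in> verts G" "v \<in> verts H" for u v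
    using that by (simp_all add: nbrs_graph_join_Inl nbrs_graph_join_Inr InlI InrI)
  ultimately have "x = y \<or> y \<in> ?N x \<or> ?N x \<inter> ?N y \<noteq> {}"
    if "x \<in> verts G <+> verts H" "y \<in> verts G <+> verts H" for x y
    using that by (cases x; cases y) blast+
  then show ?thesis
    by (simp add: diam_le_two_def graph_join_def)
qed

section \<open>Irregularity of a join and the final estimate\<close>

text \<open>The degree formulas for a join hold only at vertices of the factors; restricting the
  comparison to actual edges makes them applicable inside the sum.\<close>

lemma edge_sum_cong:
  assumes eq: "\<And>u v. {u, v} \<in> edges X \<Longrightarrow> f u v = g u v"
  shows "edge_sum X f = edge_sum X g"
  unfolding edge_sum_def
proof (rule sum.cong[OF refl])
  fix e assume "e \<in> edges X"
  then have "(e = {u, v} \<and> k = f u v) \<longleftrightarrow> (e = {u, v} \<and> k = g u v)" for u v k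
    using eq by auto
  then show "(THE k. \<exists>u v. e = {u, v} \<and> k = f u v) = (THE k. \<exists>u v. e = {u, v} \<and> k = g u v)"
    by simp
qed

text \<open>Both ends of an old edge have their degrees shifted by the same amount, so its
  contribution is unchanged; only the cross edges add new terms.\<close>

lemma irr_graph_join:
  assumes G: "simple_graph G" and H: "simple_graph H"
  shows "irr (graph_join G H) = irr G + irr H
    + (\<Sum>u\<in>verts G. \<Sum>v\<in>verts H.
         \<bar>int (deg G u + card (verts H)) - int (deg H v + card (verts G))\<bar>)"
proof -
  let ?d = "\<lambda>u. int (deg (graph_join G H) u)"
  have "irr (graph_join G H) =
          edge_sum G (\<lambda>u v. \<bar>?d (Inl u) - ?d (Inl v)\<bar>)
          + edge_sum H (\<lambda>u v. \<bar>?d (Inr u) - ?d (Inr v)\<bar>)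
          + (\<Sum>u\<in>verts G. \<Sum>v\<in>verts H. \<bar>?d (Inl u) - ?d (Inr v)\<bar>)"
    unfolding irr_def by (rule edge_sum_graph_join[OF G H]) (rule abs_minus_commute)
  also have "edge_sum G (\<lambda>u v. \<bar>?d (Inl u) - ?d (Inl v)\<bar>) = irr G"
    unfolding irr_def using simple_graph_edgeD[OF G]
    by (intro edge_sum_cong) (simp add: deg_graph_join_Inl[OF G H])
  also have "edge_sum H (\<lambda>u v. \<bar>?d (Inr u) - ?d (Inr v)\<bar>) = irr H"
    unfolding irr_def using simple_graph_edgeD[OF H]
    by (intro edge_sum_cong) (simp add: deg_graph_join_Inr[OF G H])
  finally show ?thesis
    by (simp add: deg_graph_join_Inl[OF G H] deg_graph_join_Inr[OF G H])
qed

theorem theorem3: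
  fixes G :: "'a ugraph" and H :: "'b ugraph" and s1 t1 s2 t2 :: nat
  assumes "simple_graph G" and "verts G \<noteq> {}"
    and "card (verts G) = s1" and "card (edges G) = t1"
    and "simple_graph H" and "verts H \<noteq> {}"
    and "card (verts H) = s2" and "card (edges H) = t2"
  shows "Mo (graph_join G H) \<le>
           irr G + irr H + int s1 * int s2 * \<bar>int s2 - int s1\<bar>
           + 2 * (int s2 * int t1 + int s1 * int t2)"
proof -
  note G = assms(1) and H = assms(5)
  have degG: "(\<Sum>u\<in>verts G. int (deg G u)) = 2 * int t1"
    using sum_deg[OF G] assms(4) by (simp flip: of_nat_sum)
  have degH: "(\<Sum>v\<in>verts H. int (deg H v)) = 2 * int t2"
    using sum_deg[OF H] assms(8) by (simp flip: of_nat_sum)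
  \<comment> \<open>Nonemptiness of both vertex sets enters here, through the diameter
    bound.\<close>
  have "Mo (graph_join G H) = irr (graph_join G H)"
    using assms by (intro Mo_diam_le_two simple_graph_join diam_le_two_graph_join)
  also have "\<dots> = irr G + irr H
      + (\<Sum>u\<in>verts G. \<Sum>v\<in>verts H. \<bar>int (deg G u + s2) - int (deg H v + s1)\<bar>)"
    using irr_graph_join[OF G H] assms(3,7) by simp
  \<comment> \<open>Triangle inequality for \<open>(s2 - s1) + (deg G u - deg H v)\<close>, with the
    difference of the nonnegative degrees bounded by their sum.\<close>
  also have "(\<Sum>u\<in>verts G. \<Sum>v\<in>verts H. \<bar>int (deg G u + s2) - int (deg H v + s1)\<bar>)
      \<le> (\<Sum>u\<in>verts G. \<Sum>v\<in>verts H. \<bar>int s2 - int s1\<bar> + int (deg G u) + int (deg H v))"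
    by (intro sum_mono) auto
  \<comment> \<open>Each \<open>deg G u\<close> is counted \<open>s2\<close> times and each
    \<open>deg H v\<close> is counted \<open>s1\<close> times; the factor 2 comes from the handshake
    lemma.\<close>
  also have "\<dots> = int s1 * int s2 * \<bar>int s2 - int s1\<bar> + 2 * (int s2 * int t1 + int s1 * int t2)"
    using assms(3,7)
    by (simp add: sum.distrib degG degH algebra_simps flip: sum_distrib_left)
  finally show ?thesis
    by simp
qed

end
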